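(* Let $F$ be a field and let $A$ be a zero product determined $F$-algebra. If every derivation from $A$ to $A^*$ is inner, then $A$ is two-sided zero product determined.
   Context: $F$ is an arbitrary field; an algebra means an associative $F$-algebra with unity $1$; all bimodules are unital. An algebra $A$ is zero product determined (zpd) if every bilinear functional $\varphi:A\times A\to F$ with the property that for all $x,y\in A$, $xy=0$ implies $\varphi(x,y)=0$, is of the form $\varphi(x,y)=\tau(xy)$ (for all $x,y\in A$) for some linear functional $\tau$. An algebra $A$ is two-sided zero product determined (2-zpd) if every bilinear functional $\varphi:A\times A\to F$ with the property that for all $x,y\in A$, $xy=yx=0$ implies $\varphi(x,y)=0$, is of the form $\varphi(x,y)=\tau_1(xy)+\tau_2(yx)$ (for all $x,y\in A$) for some linear functionals $\tau_1,\tau_2$ on $A$. For an $A$-bimodule $M$, a linear map $\delta:A\to M$ is a derivation if $\delta(xy)=\delta(x)y+x\delta(y)$ for all $x,y\in A$; it is inner if there is $m\in M$ with $\delta(x)=xm-mx$ for all $x\in A$. The dual space $A^*$ of $A$ (all linear functionals $A\to F$) is an $A$-bimodule via $(x\cdot f)(y)=f(yx)$ and $(f\cdot x)(y)=f(xy)$ for $f\in A^*$, $x,y\in A$. *)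

theory Defs
  imports Complex_Main "HOL-Library.Function_Algebras"
begin

text \<open>
  The sort \<open>{ring, monoid_mult}\<close> is used instead of \<open>ring_1\<close> because the
  latter includes \<open>0 \<noteq> 1\<close>, which would exclude the zero algebra.
\<close>

locale unital_algebra = vector_space scale
  for scale :: "'f::field \<Rightarrow> 'a::{ring, monoid_mult} \<Rightarrow> 'a" +
  assumes scale_mult_left: "scale c x * y = scale c (x * y)"
    and scale_mult_right: "x * scale c y = scale c (x * y)"

definition linear_functional :: "('f::field \<Rightarrow> 'a::ab_group_add \<Rightarrow> 'a) \<Rightarrow> ('a \<Rightarrow> 'f) \<Rightarrow> bool" where
  "linear_functional scale f \<longleftrightarrow> Vector_Spaces.linear scale (*) f"

definition bilinear_functional ::
    "('f::field \<Rightarrow> 'a::ab_group_add \<Rightarrow> 'a) \<Rightarrow> ('a \<Rightarrow> 'a \<Rightarrow> 'f) \<Rightarrow> bool" where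
  "bilinear_functional scale \<phi> \<longleftrightarrow>
     (\<forall>x. linear_functional scale (\<lambda>y. \<phi> x y)) \<and> (\<forall>y. linear_functional scale (\<lambda>x. \<phi> x y))"

definition zpd :: "('f::field \<Rightarrow> 'a::{ring, monoid_mult} \<Rightarrow> 'a) \<Rightarrow> bool" where
  "zpd scale \<longleftrightarrow>
     (\<forall>\<phi>. bilinear_functional scale \<phi> \<and> (\<forall>x y. x * y = 0 \<longrightarrow> \<phi> x y = 0) \<longrightarrow>
        (\<exists>\<tau>. linear_functional scale \<tau> \<and> (\<forall>x y. \<phi> x y = \<tau> (x * y))))"

definition two_sided_zpd :: "('f::field \<Rightarrow> 'a::{ring, monoid_mult} \<Rightarrow> 'a) \<Rightarrow> bool" where
  "two_sided_zpd scale \<longleftrightarrow>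
     (\<forall>\<phi>. bilinear_functional scale \<phi> \<and> (\<forall>x y. x * y = 0 \<and> y * x = 0 \<longrightarrow> \<phi> x y = 0) \<longrightarrow>
        (\<exists>\<tau>\<^sub>1 \<tau>\<^sub>2. linear_functional scale \<tau>\<^sub>1 \<and> linear_functional scale \<tau>\<^sub>2 \<and>
           (\<forall>x y. \<phi> x y = \<tau>\<^sub>1 (x * y) + \<tau>\<^sub>2 (y * x))))"

text \<open>
  A bimodule is given by a subspace \<open>M\<close> of an ambient vector space, so that the
  dual space, a subspace of the space of all functions, is an instance.
\<close>

locale unital_bimodule =
  A: unital_algebra scale + V: vector_space scaleM
  for scale :: "'f::field \<Rightarrow> 'a::{ring, monoid_mult} \<Rightarrow> 'a"
    and scaleM :: "'f \<Rightarrow> 'm::ab_group_add \<Rightarrow> 'm" +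
  fixes M :: "'m set"
    and lact :: "'a \<Rightarrow> 'm \<Rightarrow> 'm"
    and ract :: "'m \<Rightarrow> 'a \<Rightarrow> 'm"
  assumes subspace: "V.subspace M"
    and lact_closed: "m \<in> M \<Longrightarrow> lact x m \<in> M"
    and ract_closed: "m \<in> M \<Longrightarrow> ract m x \<in> M"
    and lact_add_left: "m \<in> M \<Longrightarrow> lact (x + y) m = lact x m + lact y m"
    and lact_add_right: "m \<in> M \<Longrightarrow> n \<in> M \<Longrightarrow> lact x (m + n) = lact x m + lact x n"
    and ract_add_left: "m \<in> M \<Longrightarrow> n \<in> M \<Longrightarrow> ract (m + n) x = ract m x + ract n x"
    and ract_add_right: "m \<in> M \<Longrightarrow> ract m (x + y) = ract m x + ract m y"
    and lact_scale_left: "m \<in> M \<Longrightarrow> lact (scale c x) m = scaleM c (lact x m)"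
    and lact_scale_right: "m \<in> M \<Longrightarrow> lact x (scaleM c m) = scaleM c (lact x m)"
    and ract_scale_left: "m \<in> M \<Longrightarrow> ract (scaleM c m) x = scaleM c (ract m x)"
    and ract_scale_right: "m \<in> M \<Longrightarrow> ract m (scale c x) = scaleM c (ract m x)"
    and lact_mult: "m \<in> M \<Longrightarrow> lact (x * y) m = lact x (lact y m)"
    and ract_mult: "m \<in> M \<Longrightarrow> ract m (x * y) = ract (ract m x) y"
    and lact_ract: "m \<in> M \<Longrightarrow> ract (lact x m) y = lact x (ract m y)"
    and lact_one: "m \<in> M \<Longrightarrow> lact 1 m = m"
    and ract_one: "m \<in> M \<Longrightarrow> ract m 1 = m"

definition derivation ::
    "('f::field \<Rightarrow> 'a::{ring, monoid_mult} \<Rightarrow> 'a) \<Rightarrow> ('f \<Rightarrow> 'm::ab_group_add \<Rightarrow> 'm) \<Rightarrow> 'm set \<Rightarrow>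
     ('a \<Rightarrow> 'm \<Rightarrow> 'm) \<Rightarrow> ('m \<Rightarrow> 'a \<Rightarrow> 'm) \<Rightarrow> ('a \<Rightarrow> 'm) \<Rightarrow> bool" where
  "derivation scale scaleM M lact ract \<delta> \<longleftrightarrow>
     Vector_Spaces.linear scale scaleM \<delta> \<and> range \<delta> \<subseteq> M \<and>
     (\<forall>x y. \<delta> (x * y) = ract (\<delta> x) y + lact x (\<delta> y))"

definition inner_derivation ::
    "'m::ab_group_add set \<Rightarrow> ('a \<Rightarrow> 'm \<Rightarrow> 'm) \<Rightarrow> ('m \<Rightarrow> 'a \<Rightarrow> 'm) \<Rightarrow> ('a \<Rightarrow> 'm) \<Rightarrow> bool" where
  "inner_derivation M lact ract \<delta> \<longleftrightarrow> (\<exists>m\<in>M. \<forall>x. \<delta> x = lact x m - ract m x)"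

definition dual_space :: "('f::field \<Rightarrow> 'a::ab_group_add \<Rightarrow> 'a) \<Rightarrow> ('a \<Rightarrow> 'f) set" where
  "dual_space scale = {f. linear_functional scale f}"

definition dual_scale :: "'f::field \<Rightarrow> ('a \<Rightarrow> 'f) \<Rightarrow> ('a \<Rightarrow> 'f)" where
  "dual_scale c f = (\<lambda>y. c * f y)"

definition dual_lact :: "'a::times \<Rightarrow> ('a \<Rightarrow> 'f) \<Rightarrow> ('a \<Rightarrow> 'f)" where
  "dual_lact x f = (\<lambda>y. f (y * x))"

definition dual_ract :: "('a::times \<Rightarrow> 'f) \<Rightarrow> 'a \<Rightarrow> ('a \<Rightarrow> 'f)" where
  "dual_ract f x = (\<lambda>y. f (x * y))"

lemma linear_functional_iff:
  assumes "vector_space scale"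
  shows "linear_functional scale f \<longleftrightarrow>
    (\<forall>x y. f (x + y) = f x + f y) \<and> (\<forall>c x. f (scale c x) = c * f x)"
proof -
  have "vector_space ((*) :: 'a \<Rightarrow> 'a \<Rightarrow> 'a)"
    by unfold_locales (auto simp: algebra_simps)
  then show ?thesis
    using assms
    by (auto simp: linear_functional_def Vector_Spaces.linear_def module_hom_def
        module_hom_axioms_def vector_space_def module_def)
qed

lemma vector_space_dual_scale: "vector_space (dual_scale :: 'f::field \<Rightarrow> ('a \<Rightarrow> 'f) \<Rightarrow> _)"
  by unfold_locales (auto simp: dual_scale_def fun_eq_iff algebra_simps)

lemma dual_bimodule:
  assumes "unital_algebra scale"
  shows "unital_bimodule scale dual_scale (dual_space scale) dual_lact dual_ract"
proof -
  interpret unital_algebra scale by fact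
  interpret V: vector_space "dual_scale :: 'a \<Rightarrow> ('b \<Rightarrow> 'a) \<Rightarrow> _"
    by (rule vector_space_dual_scale)
  have lf: "linear_functional scale f \<longleftrightarrow>
      (\<forall>x y. f (x + y) = f x + f y) \<and> (\<forall>c x. f (scale c x) = c * f x)" for f
    by (rule linear_functional_iff) (rule vector_space_axioms)
  show ?thesis
    by unfold_locales
      (auto simp: V.subspace_def dual_space_def lf dual_scale_def dual_lact_def dual_ract_def
        fun_eq_iff algebra_simps scale_mult_left scale_mult_right)
qed

end

theory Submission imports Defs begin

text \<open>
  If \<open>x y = 0\<close> and \<open>z w = 0\<close>, then \<open>w x\<close> and \<open>y z\<close> annihilate each other on both sides, so
  \<open>\<phi> (w x) (y z) = 0\<close>. Applying the zero product property once to the pair \<open>(x, y)\<close> and once to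
  the pair \<open>(z, w)\<close> turns this into the identity
  \<open>\<phi> (w x) (y z) - \<phi> w (x y z) = \<phi> (z w x) y - \<phi> (z w) (x y)\<close>, valid everywhere. Its special
  cases say that \<open>\<delta> x y = \<phi> x y - \<phi> 1 (x y)\<close> defines a derivation into the dual space, and
  innerness of \<open>\<delta>\<close> is the required representation of \<open>\<phi>\<close>.
\<close>

lemma (in unital_algebra) bilinear_functional_iff:
  "bilinear_functional scale \<phi> \<longleftrightarrow>
    (\<forall>x y z. \<phi> x (y + z) = \<phi> x y + \<phi> x z) \<and> (\<forall>x y z. \<phi> (x + y) z = \<phi> x z + \<phi> y z) \<and>
    (\<forall>c x y. \<phi> x (scale c y) = c * \<phi> x y) \<and> (\<forall>c x y. \<phi> (scale c x) y = c * \<phi> x y)"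
  unfolding bilinear_functional_def linear_functional_iff[OF vector_space_axioms] by auto

text \<open>The pairs (x, y) and (1, x y) have the same product, so the representing functional
  takes equal values on them. This trades the existential in \<open>zpd\<close> for an
  equation.\<close>

lemma zpd_eq_one_left:
  fixes scale :: "'f::field \<Rightarrow> 'a::{ring, monoid_mult} \<Rightarrow> 'a"
  assumes "zpd scale" "bilinear_functional scale \<phi>"
    and "\<And>x y. x * y = 0 \<Longrightarrow> \<phi> x y = 0"
  shows "\<phi> x y = \<phi> 1 (x * y)"
proof -
  obtain \<tau> where "\<And>x y. \<phi> x y = \<tau> (x * y)"
    using assms unfolding zpd_def by blast
  then show ?thesis by simp
qed

lemma (in unital_algebra) two_sided_zero_product_identity:
  assumes zpd: "zpd scale" and bil: "bilinear_functional scale \<phi>"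
    and zero: "\<And>x y. x * y = 0 \<Longrightarrow> y * x = 0 \<Longrightarrow> \<phi> x y = 0"
  shows "\<phi> (w * x) (y * z) - \<phi> w (x * y * z) = \<phi> (z * w * x) y - \<phi> (z * w) (x * y)"
proof -
  note bil' = bil[unfolded bilinear_functional_iff]
  \<comment> \<open>First application: z and w are frozen with z w = 0, and the form varies in x and
    y.\<close>
  have inner: "\<phi> (w * x) (y * z) = \<phi> w (x * y * z)" if "z * w = 0" for w x y z
  proof -
    have "\<phi> (w * x) (y * z) = \<phi> (w * 1) ((x * y) * z)"
    proof (rule zpd_eq_one_left[OF zpd, where \<phi> = "\<lambda>x y. \<phi> (w * x) (y * z)"])
      show "bilinear_functional scale (\<lambda>x y. \<phi> (w * x) (y * z))"
        using bil' unfolding bilinear_functional_iff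
        by (simp add: distrib_left distrib_right scale_mult_left scale_mult_right)
    next
      fix x y :: 'a assume "x * y = 0"
      show "\<phi> (w * x) (y * z) = 0"
      proof (rule zero)
        have "w * x * (y * z) = w * (x * y) * z" by (simp add: mult.assoc)
        then show "w * x * (y * z) = 0" using \<open>x * y = 0\<close> by simp
        have "y * z * (w * x) = y * (z * w) * x" by (simp add: mult.assoc)
        then show "y * z * (w * x) = 0" using that by simp
      qed
    qed
    then show ?thesis by simp
  qed
  \<comment> \<open>Second application: x and y are frozen. The form takes z as its first argument,
    because \<open>inner\<close> makes it vanish when z w = 0.\<close>
  have "\<phi> (w * x) (y * z) - \<phi> w (x * y * z) =
      \<phi> (z * w * x) (y * 1) - \<phi> (z * w) (x * y * 1)"
  proof (rule zpd_eq_one_left[OF zpd, where \<phi> = "\<lambda>z w. \<phi> (w * x) (y * z) - \<phi> w (x * y * z)"])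
    show "bilinear_functional scale (\<lambda>z w. \<phi> (w * x) (y * z) - \<phi> w (x * y * z))"
      using bil' unfolding bilinear_functional_iff
      by (simp add: distrib_left distrib_right scale_mult_left scale_mult_right right_diff_distrib)
  qed (simp add: inner)
  then show ?thesis by simp
qed

lemma (in unital_algebra) two_sided_zero_product_derivation:
  assumes zpd: "zpd scale" and bil: "bilinear_functional scale \<phi>"
    and zero: "\<And>x y. x * y = 0 \<Longrightarrow> y * x = 0 \<Longrightarrow> \<phi> x y = 0"
  shows "derivation scale dual_scale (dual_space scale) dual_lact dual_ract
    (\<lambda>x y. \<phi> x y - \<phi> 1 (x * y))"
proof -
  note bil' = bil[unfolded bilinear_functional_iff]
  have shift: "\<phi> (w * x) z - \<phi> w (x * z) = \<phi> (z * w * x) 1 - \<phi> (z * w) x" for w x z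
    using two_sided_zero_product_identity[OF zpd bil zero, of w x 1 z] by simp
  have sym: "\<phi> x z + \<phi> z x = \<phi> 1 (x * z) + \<phi> (z * x) 1" for x z
    using shift[of 1 x z] by (simp add: algebra_simps)
  \<comment> \<open>The left side of \<open>sym\<close> is symmetric in x and z, so its right side
    is too: the functional taking a to \<open>\<phi> a 1 - \<phi> 1 a\<close> vanishes on
    commutators.\<close>
  have trace: "\<phi> (x * z) 1 - \<phi> 1 (x * z) = \<phi> (z * x) 1 - \<phi> 1 (z * x)" for x z
    using sym[of x z] sym[of z x] by (simp add: algebra_simps)
  \<comment> \<open>This is the Leibniz rule for the product w x, evaluated at z, with the common
    term \<open>\<phi> 1 (w * x * z)\<close> cancelled. In \<open>shift\<close>, \<open>sym\<close>
    turns \<open>\<phi> (z * w) x\<close> into \<open>\<phi> x (z * w)\<close>, and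
    \<open>trace\<close> clears the terms with second argument 1.\<close>
  have leibniz: "\<phi> (w * x) z = \<phi> w (x * z) + \<phi> x (z * w) - \<phi> 1 (x * (z * w))" for w x z
    using shift[of w x z] sym[of "z * w" x] trace[of "z * w" x] by algebra
  interpret D: vector_space "dual_scale :: 'f \<Rightarrow> ('a \<Rightarrow> 'f) \<Rightarrow> _"
    by (rule vector_space_dual_scale)
  let ?\<delta> = "\<lambda>x y. \<phi> x y - \<phi> 1 (x * y)"
  have "Vector_Spaces.linear scale dual_scale ?\<delta>"
    using bil'
    by unfold_locales
      (simp_all add: fun_eq_iff dual_scale_def distrib_right scale_mult_left right_diff_distrib)
  moreover have "range ?\<delta> \<subseteq> dual_space scale"
    using bil'
    by (auto simp: dual_space_def linear_functional_iff[OF vector_space_axioms] distrib_left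
        scale_mult_right right_diff_distrib)
  moreover have "?\<delta> (x * y) = dual_ract (?\<delta> x) y + dual_lact x (?\<delta> y)" for x y
    by (simp add: fun_eq_iff dual_ract_def dual_lact_def leibniz[of x y] mult.assoc)
  ultimately show ?thesis
    unfolding derivation_def by blast
qed

theorem theorem3p1:
  fixes scale :: "'f::field \<Rightarrow> 'a::{ring, monoid_mult} \<Rightarrow> 'a"
  assumes "unital_algebra scale"
    and "zpd scale"
    and "\<And>\<delta>. derivation scale dual_scale (dual_space scale) dual_lact dual_ract \<delta> \<Longrightarrow>
           inner_derivation (dual_space scale) dual_lact dual_ract \<delta>"
  shows "two_sided_zpd scale"
  unfolding two_sided_zpd_def
proof (intro allI impI, elim conjE)
  interpret unital_algebra scale by fact
  note lf = linear_functional_iff[OF vector_space_axioms]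
  fix \<phi> assume bil: "bilinear_functional scale \<phi>"
    and zero: "\<forall>x y. x * y = 0 \<and> y * x = 0 \<longrightarrow> \<phi> x y = 0"
  have "inner_derivation (dual_space scale) dual_lact dual_ract (\<lambda>x y. \<phi> x y - \<phi> 1 (x * y))"
    using zero by (intro assms(3) two_sided_zero_product_derivation assms(2) bil) auto
  then obtain m where m: "linear_functional scale m"
    and eq: "\<And>x y. \<phi> x y - \<phi> 1 (x * y) = m (y * x) - m (x * y)"
    unfolding inner_derivation_def dual_space_def
    by (auto simp: fun_eq_iff dual_lact_def dual_ract_def)
  \<comment> \<open>Solving \<open>eq\<close> for \<open>\<phi> x y\<close> and collecting the terms
    in x y gives this functional as the first witness; m is the second.\<close>
  have "linear_functional scale (\<lambda>x. \<phi> 1 x - m x)"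
    using bil m by (simp add: bilinear_functional_def lf right_diff_distrib)
  moreover have "\<phi> x y = (\<phi> 1 (x * y) - m (x * y)) + m (y * x)" for x y
    using eq[of x y] by (simp add: algebra_simps)
  ultimately show "\<exists>\<tau>\<^sub>1 \<tau>\<^sub>2. linear_functional scale \<tau>\<^sub>1 \<and> linear_functional scale \<tau>\<^sub>2 \<and>
      (\<forall>x y. \<phi> x y = \<tau>\<^sub>1 (x * y) + \<tau>\<^sub>2 (y * x))"
    using m by blast
qed

end
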